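(* There exist 12-stone necklace diagrams with identity monodromy which are not a necklace sum (neither a mild sum nor a harsh sum) of two 6-stone necklace diagrams with identity monodromy.
   Context: Necklace diagrams. An oriented necklace diagram is an oriented circle carrying finitely many (at least one) stones of four types $\circ$, $\square$, $>$, $<$; two are identical if they have the same stones in the same cyclic order, i.e. it is a cyclic word in the four stones. Non-oriented diagrams are considered up to symmetry: reversing the cyclic order and interchanging $>$ and $<$. Necklace sums of non-oriented diagrams are taken by fixing auxiliary orientations on them. Monodromy. Write $PSL(2,\mathbb{Z})=\langle x,y\mid x^2=y^3=1\rangle$. The monodromies of stones are $\mathbb{P}_{\square}=yxy$, $\mathbb{P}_{\circ}=xyxyx$, $\mathbb{P}_{>}=y^2x$, $\mathbb{P}_{<}=xy^2$. The monodromy of an oriented necklace diagram is the product of the monodromies of its stones in cyclic order; being the identity does not depend on the starting point. Necklace sums. Mild sum: cut each of two oriented diagrams at a point of the chain (between stones) and reglue crosswise respecting the orientation; in other words, concatenate linear words representing the two cyclic words. Harsh sum: cut each of the two diagrams at a stone and reglue crosswise. Concretely, each stone is an ordered pair of marks: $\square=(\times,\times)$, $\circ=(\circ,\circ)$, $>\,=(\times,\circ)$, $<\,=(\circ,\times)$; if the two diagrams are the cyclic words $(p_1,q_1)w_1$ and $(p_2,q_2)w_2$, where $(p_i,q_i)$ is the stone at which the $i$-th diagram is cut and $w_i$ is the linear word of remaining stones, the harsh sum is the cyclic word $w_1\,(p_1,q_2)\,w_2\,(p_2,q_1)$. *)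

theory Defs
  imports "HOL-Analysis.Determinants" "HOL-Algebra.Coset"
begin

section \<open>The modular group\<close>

definition SL2Z :: "(int ^ 2 ^ 2) monoid" where
  "SL2Z = \<lparr>carrier = {A. det A = 1}, mult = (**), one = mat 1\<rparr>"

definition PSL2Z :: "(int ^ 2 ^ 2) set monoid" where
  "PSL2Z = SL2Z Mod {mat 1, - mat 1}"

definition mat2 :: "int \<Rightarrow> int \<Rightarrow> int \<Rightarrow> int \<Rightarrow> int ^ 2 ^ 2" where
  "mat2 a b c d = vector [vector [a, b], vector [c, d]]"

definition psl :: "int ^ 2 ^ 2 \<Rightarrow> (int ^ 2 ^ 2) set" where
  "psl A = {mat 1, - mat 1} #>\<^bsub>SL2Z\<^esub> A"

text \<open>
  Only the presentation \<open>\<langle>x, y | x\<^sup>2 = y\<^sup>3 = 1\<rangle>\<close> of \<^const>\<open>PSL2Z\<close> matters for necklace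
  diagrams. The following matrices are one choice of generators realizing it; that they do is
  proved below (\<open>PSL2Z_generated\<close>, \<open>PSL2Z_relations\<close>).
\<close>

definition psl_x :: "(int ^ 2 ^ 2) set" where
  "psl_x = psl (mat2 0 (-1) 1 0)"

definition psl_y :: "(int ^ 2 ^ 2) set" where
  "psl_y = psl (mat2 0 (-1) 1 1)"

lemma mat2_exhaust: obtains a b c d where "A = mat2 a b c d"
proof
  show "A = mat2 (A $ 1 $ 1) (A $ 1 $ 2) (A $ 2 $ 1) (A $ 2 $ 2)"
    by (simp add: mat2_def vec_eq_iff forall_2)
qed

lemma mat2_eq_iff [simp]:
  "mat2 a b c d = mat2 a' b' c' d' \<longleftrightarrow> a = a' \<and> b = b' \<and> c = c' \<and> d = d'"
  by (auto simp: mat2_def vec_eq_iff forall_2)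

lemma mat2_mult [simp]:
  "mat2 a b c d ** mat2 a' b' c' d' =
    mat2 (a * a' + b * c') (a * b' + b * d') (c * a' + d * c') (c * b' + d * d')"
  by (simp add: mat2_def vec_eq_iff forall_2 matrix_matrix_mult_def sum_2)

lemma mat2_uminus [simp]: "- mat2 a b c d = mat2 (- a) (- b) (- c) (- d)"
  by (simp add: mat2_def vec_eq_iff forall_2)

lemma mat2_one: "mat 1 = mat2 1 0 0 1"
  by (simp add: mat2_def vec_eq_iff forall_2 mat_def)

lemma mat2_det [simp]: "det (mat2 a b c d) = a * d - b * c"
  by (simp add: det_2 mat2_def)

lemma mat2_minus_mult [simp]:
  fixes A B :: "int ^ 2 ^ 2"
  shows "(- A) ** B = - (A ** B)" "A ** (- B) = - (A ** B)"
  by (cases A rule: mat2_exhaust; cases B rule: mat2_exhaust; simp)+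

lemma SL2Z_simps [simp]:
  "carrier SL2Z = {A. det A = 1}" "mult SL2Z = (**)" "one SL2Z = mat 1"
  by (simp_all add: SL2Z_def)

lemma group_SL2Z: "group SL2Z"
proof (rule groupI)
  fix A assume "A \<in> carrier SL2Z"
  moreover obtain a b c d where A: "A = mat2 a b c d" by (rule mat2_exhaust)
  ultimately show "\<exists>B\<in>carrier SL2Z. B \<otimes>\<^bsub>SL2Z\<^esub> A = \<one>\<^bsub>SL2Z\<^esub>"
    by (intro bexI[of _ "mat2 d (- b) (- c) a"]) (auto simp: mat2_one algebra_simps)
qed (auto simp: det_mul matrix_mul_assoc)

lemma det_minus_2: "det (- A) = det A" for A :: "int ^ 2 ^ 2"
  by (cases A rule: mat2_exhaust) simp

lemma psl_eq: "psl A = {A, - A}"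
  by (auto simp: psl_def r_coset_def)

lemma psl_eq_iff: "psl A = psl B \<longleftrightarrow> A = B \<or> A = - B"
  unfolding psl_eq doubleton_eq_iff by auto

lemma center_normal: "{mat 1, - mat 1} \<lhd> SL2Z"
proof -
  interpret group SL2Z by (rule group_SL2Z)
  have inv: "inv\<^bsub>SL2Z\<^esub> (- mat 1) = - mat 1"
    by (rule inv_equality) (auto simp: det_minus_2)
  have "subgroup {mat 1, - mat 1} SL2Z"
    by (rule subgroupI) (use inv inv_one in \<open>auto simp: det_minus_2\<close>)
  then show ?thesis
    by (intro normalI) (auto simp: r_coset_def l_coset_def)
qed

lemma group_PSL2Z: "group PSL2Z"
  unfolding PSL2Z_def by (rule normal.factorgroup_is_group[OF center_normal])

lemma PSL2Z_carrier: "carrier PSL2Z = psl ` {A. det A = 1}"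
  by (auto simp: PSL2Z_def FactGroup_def RCOSETS_def psl_def)

lemma PSL2Z_one: "\<one>\<^bsub>PSL2Z\<^esub> = psl (mat 1)"
  by (simp add: PSL2Z_def psl_eq)

lemma PSL2Z_mult: "psl A \<otimes>\<^bsub>PSL2Z\<^esub> psl B = psl (A ** B)"
  by (auto simp: PSL2Z_def FactGroup_def set_mult_def psl_eq)


subsection \<open>The presentation\<close>

datatype gen = X | Y

fun gen_matrix :: "gen \<Rightarrow> int ^ 2 ^ 2" where
  "gen_matrix X = mat2 0 (-1) 1 0"
| "gen_matrix Y = mat2 0 (-1) 1 1"

fun word_matrix :: "gen list \<Rightarrow> int ^ 2 ^ 2" where
  "word_matrix [] = mat 1"
| "word_matrix (g # u) = gen_matrix g ** word_matrix u"

definition psl_word :: "gen list \<Rightarrow> (int ^ 2 ^ 2) set" where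
  "psl_word u = foldr (\<lambda>g h. (case g of X \<Rightarrow> psl_x | Y \<Rightarrow> psl_y) \<otimes>\<^bsub>PSL2Z\<^esub> h) u \<one>\<^bsub>PSL2Z\<^esub>"

text \<open>
  The congruence generated by the two relations. Since they make both generators invertible, the
  group and the monoid with this presentation coincide, so positive words suffice.
\<close>

inductive rel_eq :: "gen list \<Rightarrow> gen list \<Rightarrow> bool" where
  rel_refl: "rel_eq u u"
| rel_sym: "rel_eq u v \<Longrightarrow> rel_eq v u"
| rel_trans: "rel_eq u v \<Longrightarrow> rel_eq v w \<Longrightarrow> rel_eq u w"
| rel_append: "rel_eq u v \<Longrightarrow> rel_eq u' v' \<Longrightarrow> rel_eq (u @ u') (v @ v')"
| rel_xx: "rel_eq [X, X] []"
| rel_yyy: "rel_eq [Y, Y, Y] []"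

lemma psl_word_matrix: "psl_word u = psl (word_matrix u)"
proof (induction u)
  case (Cons g u)
  then show ?case
    by (cases g) (simp_all add: psl_word_def psl_x_def psl_y_def PSL2Z_mult)
qed (simp add: psl_word_def PSL2Z_one)

lemma word_matrix_append: "word_matrix (u @ v) = word_matrix u ** word_matrix v"
  by (induction u) (simp_all add: matrix_mul_assoc)

lemma psl_word_append: "psl_word (u @ v) = psl_word u \<otimes>\<^bsub>PSL2Z\<^esub> psl_word v"
  by (simp add: psl_word_matrix word_matrix_append PSL2Z_mult)

lemma rel_eq_sound: "rel_eq u v \<Longrightarrow> psl_word u = psl_word v"
  by (induction rule: rel_eq.induct)
     (simp_all add: psl_word_append, simp_all add: psl_word_matrix psl_eq_iff mat2_one)

lemma det_word_matrix: "det (word_matrix u) = 1"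
proof (induction u)
  case (Cons g u) then show ?case by (cases g) (simp_all add: det_mul)
qed simp

text \<open>Every word is congruent to some \<open>y\<^sup>i T x\<^sup>j\<close> with \<open>T\<close> a product of blocks \<open>xy\<close>, \<open>xy\<^sup>2\<close>.\<close>

definition blocks :: "bool list \<Rightarrow> gen list" where
  "blocks bs = concat (map (\<lambda>b. if b then [X, Y] else [X, Y, Y]) bs)"

definition nf :: "gen list \<Rightarrow> bool" where
  "nf w \<longleftrightarrow> (\<exists>p\<in>{[], [Y], [Y, Y]}. \<exists>bs. \<exists>q\<in>{[], [X]}. w = p @ blocks bs @ q)"

lemma rel_context: "rel_eq u v \<Longrightarrow> rel_eq (a @ u @ b) (a @ v @ b)"
  by (intro rel_append rel_refl)

lemma nf_cons:
  assumes "nf w"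
  shows "\<exists>w'. nf w' \<and> rel_eq (g # w) w'"
proof -
  obtain p bs q where p: "p \<in> {[], [Y], [Y, Y]}" and q: "q \<in> {[], [X]}"
    and w: "w = p @ blocks bs @ q"
    using assms unfolding nf_def by blast
  have nfI: "nf (p' @ blocks bs' @ q')"
    if "p' \<in> {[], [Y], [Y, Y]}" "q' \<in> {[], [X]}" for p' bs' q'
    using that unfolding nf_def by blast
  show ?thesis
  proof (cases g)
    case Y
    consider "p = []" | "p = [Y]" | "p = [Y, Y]" using p by blast
    then show ?thesis
    proof cases
      case 1
      then show ?thesis using nfI[of "[Y]" q bs] q Y w rel_refl by force
    next
      case 2
      then show ?thesis using nfI[of "[Y, Y]" q bs] q Y w rel_refl by force
    next
      case 3
      then show ?thesis
        using nfI[of "[]" q bs] q Y w rel_context[OF rel_yyy, of "[]" "blocks bs @ q"] by auto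
    qed
  next
    case X
    consider "p = [Y]" | "p = [Y, Y]" | "p = []" "bs = []" "q = []" | "p = []" "bs = []" "q = [X]"
      | bs' where "p = []" "bs = True # bs'" | bs' where "p = []" "bs = False # bs'"
      using p q by (cases bs) auto
    then show ?thesis
    proof cases
      case 1
      then show ?thesis
        using nfI[of "[]" q "True # bs"] q X w rel_refl by (force simp: blocks_def)
    next
      case 2
      then show ?thesis
        using nfI[of "[]" q "False # bs"] q X w rel_refl by (force simp: blocks_def)
    next
      case 3
      then show ?thesis
        using nfI[of "[]" "[X]" "[]"] X w rel_refl by (force simp: blocks_def)
    next
      case 4
      then show ?thesis
        using nfI[of "[]" "[]" "[]"] X w rel_xx by (force simp: blocks_def)
    next
      case 5
      then show ?thesis
        using nfI[of "[Y]" q bs'] q X w rel_context[OF rel_xx, of "[]" "Y # blocks bs' @ q"]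
        by (force simp: blocks_def)
    next
      case 6
      then show ?thesis
        using nfI[of "[Y, Y]" q bs'] q X w rel_context[OF rel_xx, of "[]" "Y # Y # blocks bs' @ q"]
        by (force simp: blocks_def)
    qed
  qed
qed

lemma nf_exists: "\<exists>w. nf w \<and> rel_eq u w"
proof (induction u)
  case Nil
  have "nf []"
    unfolding nf_def by (intro bexI[of _ "[]"] exI[of _ "[]"]) (auto simp: blocks_def)
  then show ?case using rel_refl by blast
next
  case (Cons g u)
  then obtain w where w: "nf w" "rel_eq u w" by blast
  obtain w' where "nf w'" "rel_eq (g # w) w'" using nf_cons[OF w(1)] by blast
  moreover have "rel_eq (g # u) (g # w)"
    using rel_append[OF rel_refl[of "[g]"] w(2)] by simp
  ultimately show ?case using rel_trans by blast
qed

lemma blocks_matrix: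
  "\<exists>a b c d s. word_matrix (blocks bs) = mat2 (s * a) (s * b) (s * c) (s * d) \<and> s \<in> {1, -1} \<and>
     a \<ge> 1 \<and> d \<ge> 1 \<and> b \<ge> 0 \<and> c \<ge> 0 \<and> (bs \<noteq> [] \<longrightarrow> b + c \<ge> 1)"
proof (induction bs)
  case Nil
  then show ?case
    by (rule exI[of _ 1], rule exI[of _ 0], rule exI[of _ 0], rule exI[of _ 1], rule exI[of _ 1])
       (simp add: blocks_def mat2_one)
next
  case (Cons t bs)
  then obtain a b c d s where *: "word_matrix (blocks bs) = mat2 (s * a) (s * b) (s * c) (s * d)"
    "s \<in> {1, -1}" "a \<ge> 1" "d \<ge> 1" "b \<ge> 0" "c \<ge> 0" by blast
  have split: "blocks (t # bs) = (if t then [X, Y] else [X, Y, Y]) @ blocks bs" for t bs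
    by (simp add: blocks_def)
  show ?case
  proof (cases t)
    case True
    have "word_matrix (blocks (t # bs)) =
        mat2 ((- s) * (a + c)) ((- s) * (b + d)) ((- s) * c) ((- s) * d)"
      using True by (simp add: split word_matrix_append *(1) mat2_one algebra_simps)
    then show ?thesis
      using *(2-)
      by - (rule exI[of _ "a + c"], rule exI[of _ "b + d"], rule exI[of _ "c"], rule exI[of _ "d"],
          rule exI[of _ "- s"], auto)
  next
    case False
    have "word_matrix (blocks (t # bs)) =
        mat2 ((- s) * a) ((- s) * b) ((- s) * (a + c)) ((- s) * (b + d))"
      using False by (simp add: split word_matrix_append *(1) mat2_one algebra_simps)
    then show ?thesis
      using *(2-)
      by - (rule exI[of _ "a"], rule exI[of _ "b"], rule exI[of _ "a + c"], rule exI[of _ "b + d"],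
          rule exI[of _ "- s"], auto)
  qed
qed

lemma nf_trivial:
  assumes "nf w" "psl_word w = \<one>\<^bsub>PSL2Z\<^esub>"
  shows "w = []"
proof -
  obtain p bs q where p: "p \<in> {[], [Y], [Y, Y]}" and q: "q \<in> {[], [X]}"
    and w: "w = p @ blocks bs @ q"
    using assms(1) unfolding nf_def by blast
  obtain a b c d s where *: "word_matrix (blocks bs) = mat2 (s * a) (s * b) (s * c) (s * d)"
    "s \<in> {1, -1}" "a \<ge> 1" "d \<ge> 1" "b \<ge> 0" "c \<ge> 0" "bs \<noteq> [] \<longrightarrow> b + c \<ge> 1"
    using blocks_matrix[of bs] by blast
  have "word_matrix w = mat2 1 0 0 1 \<or> word_matrix w = mat2 (-1) 0 0 (-1)"
    using assms(2) by (simp add: psl_word_matrix PSL2Z_one psl_eq_iff mat2_one)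
  then have M: "word_matrix p ** (mat2 (s * a) (s * b) (s * c) (s * d) ** word_matrix q) =
      mat2 1 0 0 1 \<or> word_matrix p ** (mat2 (s * a) (s * b) (s * c) (s * d) ** word_matrix q) =
      mat2 (-1) 0 0 (-1)"
    by (simp add: w word_matrix_append *(1))
  consider "s = 1" | "s = -1" using *(2) by blast
  then have "p = [] \<and> q = [] \<and> b + c = 0"
  proof cases
    case 1
    consider "p = []" "q = []" | "p = [Y]" "q = []" | "p = [Y, Y]" "q = []"
      | "p = []" "q = [X]" | "p = [Y]" "q = [X]" | "p = [Y, Y]" "q = [X]" using p q by blast
    then show ?thesis by cases (use M *(3-6) 1 in \<open>auto simp: mat2_one\<close>)
  next
    case 2
    consider "p = []" "q = []" | "p = [Y]" "q = []" | "p = [Y, Y]" "q = []"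
      | "p = []" "q = [X]" | "p = [Y]" "q = [X]" | "p = [Y, Y]" "q = [X]" using p q by blast
    then show ?thesis by cases (use M *(3-6) 2 in \<open>auto simp: mat2_one\<close>)
  qed
  with *(7) w show ?thesis by (auto simp: blocks_def)
qed

fun gen_inv :: "gen \<Rightarrow> gen list" where
  "gen_inv X = [X]"
| "gen_inv Y = [Y, Y]"

lemma rel_inverse: "\<exists>v. rel_eq (u @ v) [] \<and> rel_eq (v @ u) []"
proof (induction u)
  case Nil then show ?case using rel_refl by auto
next
  case (Cons g u)
  then obtain v where v: "rel_eq (u @ v) []" "rel_eq (v @ u) []" by blast
  have g: "rel_eq (g # gen_inv g) []" "rel_eq (gen_inv g @ [g]) []"
    by (cases g; simp add: rel_xx rel_yyy)+
  have "rel_eq ((g # u) @ (v @ gen_inv g)) []"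
    using rel_trans[OF rel_context[OF v(1), of "[g]" "gen_inv g"]] g(1) by simp
  moreover have "rel_eq ((v @ gen_inv g) @ (g # u)) []"
    using rel_trans[OF rel_context[OF g(2), of v u]] v(2) by simp
  ultimately show ?case by blast
qed

lemma psl_word_carrier: "psl_word u \<in> carrier PSL2Z"
  by (auto simp: psl_word_matrix PSL2Z_carrier det_word_matrix)

theorem PSL2Z_relations: "psl_word u = psl_word v \<longleftrightarrow> rel_eq u v"
proof
  assume eq: "psl_word u = psl_word v"
  obtain v' where v': "rel_eq (v @ v') []" "rel_eq (v' @ v) []" using rel_inverse by blast
  have "psl_word (u @ v') = psl_word (v @ v')" using eq by (simp add: psl_word_append)
  also have "\<dots> = psl_word []" using v'(1) by (rule rel_eq_sound)
  finally have one: "psl_word (u @ v') = \<one>\<^bsub>PSL2Z\<^esub>" by (simp add: psl_word_def)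
  obtain w where w: "nf w" "rel_eq (u @ v') w" using nf_exists by blast
  with one have "w = []" using nf_trivial rel_eq_sound by metis
  with w have "rel_eq (u @ v') []" by simp
  from rel_append[OF this rel_refl[of v]] have "rel_eq (u @ v' @ v) v" by simp
  moreover have "rel_eq (u @ v' @ v) u" using rel_append[OF rel_refl[of u] v'(2)] by simp
  ultimately show "rel_eq u v" using rel_sym rel_trans by blast
qed (rule rel_eq_sound)

lemma psl_range_mult:
  assumes "psl (word_matrix u ** A) \<in> range psl_word"
  shows "psl A \<in> range psl_word"
proof -
  obtain u' where u': "rel_eq (u' @ u) []" using rel_inverse by blast
  obtain w where w: "psl (word_matrix u ** A) = psl_word w" using assms by blast
  have eq: "psl (word_matrix (u' @ u)) = psl (mat 1)"
    using rel_eq_sound[OF u'] by (simp add: psl_word_matrix)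
  have "psl A = psl (word_matrix (u' @ u) ** A)"
    using eq PSL2Z_mult[of "word_matrix (u' @ u)" A] PSL2Z_mult[of "mat 1" A] by simp
  also have "\<dots> = psl_word (u' @ w)"
    using w by (simp add: word_matrix_append psl_word_append matrix_mul_assoc[symmetric]
        psl_word_matrix PSL2Z_mult[symmetric])
  finally show ?thesis by blast
qed

lemma psl_minus: "psl (- A) = psl A"
  by (simp add: psl_eq_iff)

lemma range_add_row1:
  assumes "psl (mat2 (a + c) (b + d) c d) \<in> range psl_word"
  shows "psl (mat2 a b c d) \<in> range psl_word"
proof (rule psl_range_mult[of "[X, Y]"])
  have "word_matrix [X, Y] ** mat2 a b c d = - (mat2 (a + c) (b + d) c d)"
    by (simp add: mat2_one)
  then show "psl (word_matrix [X, Y] ** mat2 a b c d) \<in> range psl_word"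
    using assms by (simp only: psl_minus)
qed

lemma range_diff_row1:
  assumes "psl (mat2 (a - c) (b - d) c d) \<in> range psl_word"
  shows "psl (mat2 a b c d) \<in> range psl_word"
proof (rule psl_range_mult[of "[Y, Y, X]"])
  have "word_matrix [Y, Y, X] ** mat2 a b c d = - (mat2 (a - c) (b - d) c d)"
    by (simp add: mat2_one)
  then show "psl (word_matrix [Y, Y, X] ** mat2 a b c d) \<in> range psl_word"
    using assms by (simp only: psl_minus)
qed

lemma range_add_row2:
  assumes "psl (mat2 a b (a + c) (b + d)) \<in> range psl_word"
  shows "psl (mat2 a b c d) \<in> range psl_word"
proof (rule psl_range_mult[of "[X, Y, Y]"])
  have "word_matrix [X, Y, Y] ** mat2 a b c d = - (mat2 a b (a + c) (b + d))"
    by (simp add: mat2_one)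
  then show "psl (word_matrix [X, Y, Y] ** mat2 a b c d) \<in> range psl_word"
    using assms by (simp only: psl_minus)
qed

lemma range_diff_row2:
  assumes "psl (mat2 a b (c - a) (d - b)) \<in> range psl_word"
  shows "psl (mat2 a b c d) \<in> range psl_word"
proof (rule psl_range_mult[of "[Y, X]"])
  have "word_matrix [Y, X] ** mat2 a b c d = - (mat2 a b (c - a) (d - b))"
    by (simp add: mat2_one)
  then show "psl (word_matrix [Y, X] ** mat2 a b c d) \<in> range psl_word"
    using assms by (simp only: psl_minus)
qed

lemma range_swap_rows:
  assumes "psl (mat2 (- c) (- d) a b) \<in> range psl_word"
  shows "psl (mat2 a b c d) \<in> range psl_word"
proof (rule psl_range_mult[of "[X]"])
  have "word_matrix [X] ** mat2 a b c d = mat2 (- c) (- d) a b"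
    by (simp add: mat2_one)
  then show "psl (word_matrix [X] ** mat2 a b c d) \<in> range psl_word"
    using assms by simp
qed

lemma range_unipotent: "psl (mat2 1 n 0 1) \<in> range psl_word"
proof (induction "nat \<bar>n\<bar>" arbitrary: n rule: less_induct)
  case less
  consider "n = 0" | "n > 0" | "n < 0" by linarith
  then show ?case
  proof cases
    case 1
    then have "psl (mat2 1 n 0 1) = psl_word []"
      by (simp add: psl_word_matrix mat2_one)
    then show ?thesis by (metis rangeI)
  next
    case 2
    then have "psl (mat2 1 (n - 1) 0 1) \<in> range psl_word" by (intro less.hyps) auto
    then show ?thesis by - (rule range_diff_row1, simp)
  next
    case 3
    then have "psl (mat2 1 (n + 1) 0 1) \<in> range psl_word" by (intro less.hyps) auto
    then show ?thesis by - (rule range_add_row1, simp)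
  qed
qed

lemma range_triangular:
  assumes "a * d = 1"
  shows "psl (mat2 a b 0 d) \<in> range psl_word"
proof -
  consider "a = 1" "d = 1" | "a = -1" "d = -1" using assms zmult_eq_1_iff by blast
  then show ?thesis
  proof cases
    case 1
    then show ?thesis using range_unipotent by simp
  next
    case 2
    then show ?thesis using range_unipotent[of "- b"] psl_minus[of "mat2 1 (- b) 0 1"] by simp
  qed
qed

lemma psl_in_range:
  "a * d - b * c = 1 \<Longrightarrow> psl (mat2 a b c d) \<in> range psl_word"
proof (induction "nat (\<bar>a\<bar> + \<bar>c\<bar>)" arbitrary: a b c d rule: less_induct)
  case less
  have det: "(a + c) * d - (b + d) * c = 1" "(a - c) * d - (b - d) * c = 1"
    "a * (b + d) - b * (a + c) = 1" "a * (d - b) - b * (c - a) = 1"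
    using less.prems by (simp_all add: algebra_simps)
  consider "c = 0" | "a = 0" | "\<bar>a + c\<bar> < \<bar>a\<bar>" | "\<bar>a - c\<bar> < \<bar>a\<bar>"
    | "\<bar>a + c\<bar> < \<bar>c\<bar>" | "\<bar>c - a\<bar> < \<bar>c\<bar>"
    by linarith
  then show ?case
  proof cases
    case 1
    then show ?thesis using less.prems range_triangular by simp
  next
    case 2
    then have "(- c) * b = 1" using less.prems by (simp add: mult.commute)
    then show ?thesis using 2 range_triangular by - (rule range_swap_rows, simp)
  next
    case 3
    then show ?thesis by - (rule range_add_row1[OF less.hyps[OF _ det(1)]], linarith)
  next
    case 4
    then show ?thesis by - (rule range_diff_row1[OF less.hyps[OF _ det(2)]], linarith)
  next
    case 5
    then show ?thesis by - (rule range_add_row2[OF less.hyps[OF _ det(3)]], linarith)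
  next
    case 6
    then show ?thesis by - (rule range_diff_row2[OF less.hyps[OF _ det(4)]], linarith)
  qed
qed

theorem PSL2Z_generated: "range psl_word = carrier PSL2Z"
proof
  show "carrier PSL2Z \<subseteq> range psl_word"
  proof
    fix h assume "h \<in> carrier PSL2Z"
    then obtain A where A: "h = psl A" "det A = 1" by (auto simp: PSL2Z_carrier)
    then show "h \<in> range psl_word"
      by (cases A rule: mat2_exhaust) (auto intro!: psl_in_range)
  qed
qed (use psl_word_carrier in blast)

lemma rel_eq_rev: "rel_eq u v \<Longrightarrow> rel_eq (rev u) (rev v)"
  by (induction rule: rel_eq.induct) (auto intro: rel_eq.intros)


section \<open>Stones and their monodromy\<close>

datatype mark = Cross | Ring

type_synonym stone = "mark \<times> mark"

text \<open>
  The \<open>\<circ>\<close>-stone, the \<open>\<box>\<close>-stone, the \<open>>\<close>-stone and the \<open><\<close>-stone; these are all elements of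
  \<^typ>\<open>stone\<close>. Reversing the orientation of a stone is \<^const>\<open>prod.swap\<close>, which interchanges
  the last two and fixes the first two.
\<close>

abbreviation circle_stone :: stone where "circle_stone \<equiv> (Ring, Ring)"
abbreviation square_stone :: stone where "square_stone \<equiv> (Cross, Cross)"
abbreviation gt_stone :: stone where "gt_stone \<equiv> (Cross, Ring)"
abbreviation lt_stone :: stone where "lt_stone \<equiv> (Ring, Cross)"

fun stone_monodromy :: "stone \<Rightarrow> (int ^ 2 ^ 2) set" where
  "stone_monodromy (Cross, Cross) = psl_y \<otimes>\<^bsub>PSL2Z\<^esub> psl_x \<otimes>\<^bsub>PSL2Z\<^esub> psl_y"
| "stone_monodromy (Ring, Ring) =
     psl_x \<otimes>\<^bsub>PSL2Z\<^esub> psl_y \<otimes>\<^bsub>PSL2Z\<^esub> psl_x \<otimes>\<^bsub>PSL2Z\<^esub> psl_y \<otimes>\<^bsub>PSL2Z\<^esub> psl_x"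
| "stone_monodromy (Cross, Ring) = psl_y [^]\<^bsub>PSL2Z\<^esub> (2 :: nat) \<otimes>\<^bsub>PSL2Z\<^esub> psl_x"
| "stone_monodromy (Ring, Cross) = psl_x \<otimes>\<^bsub>PSL2Z\<^esub> psl_y [^]\<^bsub>PSL2Z\<^esub> (2 :: nat)"

definition chain_monodromy :: "stone list \<Rightarrow> (int ^ 2 ^ 2) set" where
  "chain_monodromy w = foldr (\<lambda>s h. stone_monodromy s \<otimes>\<^bsub>PSL2Z\<^esub> h) w \<one>\<^bsub>PSL2Z\<^esub>"

fun stone_word :: "stone \<Rightarrow> gen list" where
  "stone_word (Cross, Cross) = [Y, X, Y]"
| "stone_word (Ring, Ring) = [X, Y, X, Y, X]"
| "stone_word (Cross, Ring) = [Y, Y, X]"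
| "stone_word (Ring, Cross) = [X, Y, Y]"

lemma stone_monodromy_word: "stone_monodromy s = psl_word (stone_word s)"
  by (cases s rule: stone_word.cases)
     (simp_all add: psl_word_matrix psl_x_def psl_y_def PSL2Z_mult PSL2Z_one mat2_one
       numeral_2_eq_2 nat_pow_def)

lemma chain_monodromy_word: "chain_monodromy w = psl_word (concat (map stone_word w))"
  by (induction w)
     (simp_all add: chain_monodromy_def psl_word_append stone_monodromy_word, simp add: psl_word_def)

lemma chain_monodromy_append:
  "chain_monodromy (v @ w) = chain_monodromy v \<otimes>\<^bsub>PSL2Z\<^esub> chain_monodromy w"
  by (simp add: chain_monodromy_word psl_word_append)

lemma chain_monodromy_commute:
  assumes "chain_monodromy (v @ w) = \<one>\<^bsub>PSL2Z\<^esub>"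
  shows "chain_monodromy (w @ v) = \<one>\<^bsub>PSL2Z\<^esub>"
proof -
  interpret group PSL2Z by (rule group_PSL2Z)
  have "chain_monodromy u \<in> carrier PSL2Z" for u
    by (simp add: chain_monodromy_word psl_word_carrier)
  with assms show ?thesis
    using inv_comm by (simp add: chain_monodromy_append)
qed

lemma chain_monodromy_reverse:
  "chain_monodromy (map prod.swap (rev w)) = \<one>\<^bsub>PSL2Z\<^esub> \<longleftrightarrow> chain_monodromy w = \<one>\<^bsub>PSL2Z\<^esub>"
proof -
  have s: "stone_word (prod.swap s) = rev (stone_word s)" for s
    by (cases s rule: stone_word.cases) simp_all
  have "concat (map stone_word (map prod.swap (rev w))) = rev (concat (map stone_word w))"
    by (induction w) (simp_all add: s)
  moreover have "psl_word (rev u) = \<one>\<^bsub>PSL2Z\<^esub> \<longleftrightarrow> psl_word u = \<one>\<^bsub>PSL2Z\<^esub>" for u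
    using PSL2Z_relations[of _ "[]"] rel_eq_rev[of u "[]"] rel_eq_rev[of "rev u" "[]"]
    by (auto simp: psl_word_def)
  ultimately show ?thesis by (simp add: chain_monodromy_word)
qed


section \<open>Necklace diagrams\<close>

definition same_cycle :: "stone list \<Rightarrow> stone list \<Rightarrow> bool" where
  "same_cycle v w \<longleftrightarrow> v \<noteq> [] \<and> (\<exists>n. w = rotate n v)"

lemma same_cycle_iff: "same_cycle v w \<longleftrightarrow> v \<noteq> [] \<and> (\<exists>a b. v = a @ b \<and> w = b @ a)"
proof
  assume "same_cycle v w"
  then obtain n where "v \<noteq> []" "w = rotate n v" by (auto simp: same_cycle_def)
  then show "v \<noteq> [] \<and> (\<exists>a b. v = a @ b \<and> w = b @ a)"
    by (metis append_take_drop_id rotate_drop_take)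
next
  assume "v \<noteq> [] \<and> (\<exists>a b. v = a @ b \<and> w = b @ a)"
  then show "same_cycle v w" unfolding same_cycle_def by (metis rotate_append)
qed

lemma same_cycle_refl: "w \<noteq> [] \<Longrightarrow> same_cycle w w"
  unfolding same_cycle_def by (simp add: exI[of _ 0])

lemma same_cycle_sym: "same_cycle v w \<Longrightarrow> same_cycle w v"
  unfolding same_cycle_iff by auto

lemma same_cycle_reverse:
  assumes "same_cycle v w"
  shows "same_cycle (map prod.swap (rev v)) (map prod.swap (rev w))"
proof -
  obtain a b where *: "v \<noteq> []" "v = a @ b" "w = b @ a"
    using assms by (auto simp: same_cycle_iff)
  have "map prod.swap (rev v) = map prod.swap (rev b) @ map prod.swap (rev a)"
    "map prod.swap (rev w) = map prod.swap (rev a) @ map prod.swap (rev b)"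
    using * by simp_all
  with *(1) show ?thesis unfolding same_cycle_iff by blast
qed

lemma same_cycle_trans: "same_cycle u v \<Longrightarrow> same_cycle v w \<Longrightarrow> same_cycle u w"
  by (auto simp: same_cycle_def rotate_rotate)

text \<open>
  Partial quotient of the nonempty words by rotation; \<open>cyclic_word w\<close> is the diagram represented
  by \<open>w\<close> and is meaningful only for \<open>w \<noteq> []\<close>.
\<close>

quotient_type oriented_necklace = "stone list" / partial: same_cycle
  morphisms linear_word cyclic_word
proof (rule part_equivpI)
  show "\<exists>w. same_cycle w w"
    by (rule exI[of _ "[square_stone]"]) (simp add: same_cycle_refl)
  show "symp same_cycle" using same_cycle_sym by (auto simp: symp_def)
  show "transp same_cycle" using same_cycle_trans by (auto simp: transp_def)
qed

lift_definition oriented_num_stones :: "oriented_necklace \<Rightarrow> nat" is length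
  by (auto simp: same_cycle_def)

lift_definition oriented_identity_monodromy :: "oriented_necklace \<Rightarrow> bool"
  is "\<lambda>w. chain_monodromy w = \<one>\<^bsub>PSL2Z\<^esub>"
  by (auto simp: same_cycle_iff dest: chain_monodromy_commute)

lift_definition reverse_necklace :: "oriented_necklace \<Rightarrow> oriented_necklace"
  is "\<lambda>w. map prod.swap (rev w)"
  by (rule same_cycle_reverse)

definition same_unoriented :: "oriented_necklace \<Rightarrow> oriented_necklace \<Rightarrow> bool" where
  "same_unoriented M N \<longleftrightarrow> N = M \<or> N = reverse_necklace M"

lemma reverse_reverse: "reverse_necklace (reverse_necklace M) = M"
  by transfer (auto simp: rev_map same_cycle_def)

quotient_type necklace = oriented_necklace / same_unoriented
  morphisms orientation unoriented
  by (rule equivpI)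
     (auto simp: same_unoriented_def reflp_def symp_def transp_def reverse_reverse)

lemma num_stones_reverse: "oriented_num_stones (reverse_necklace M) = oriented_num_stones M"
  by transfer simp

lemma identity_monodromy_reverse:
  "oriented_identity_monodromy (reverse_necklace M) = oriented_identity_monodromy M"
  by transfer (rule chain_monodromy_reverse)

lift_definition num_stones :: "necklace \<Rightarrow> nat" is oriented_num_stones
  by (auto simp: same_unoriented_def num_stones_reverse)

lift_definition identity_monodromy :: "necklace \<Rightarrow> bool" is oriented_identity_monodromy
  by (auto simp: same_unoriented_def identity_monodromy_reverse)


section \<open>Necklace sums\<close>

definition oriented_mild_sum ::
    "oriented_necklace \<Rightarrow> oriented_necklace \<Rightarrow> oriented_necklace \<Rightarrow> bool" where
  "oriented_mild_sum M1 M2 M \<longleftrightarrow>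
     (\<exists>w1 w2. w1 \<noteq> [] \<and> w2 \<noteq> [] \<and> M1 = cyclic_word w1 \<and> M2 = cyclic_word w2 \<and>
        M = cyclic_word (w1 @ w2))"

definition oriented_harsh_sum ::
    "oriented_necklace \<Rightarrow> oriented_necklace \<Rightarrow> oriented_necklace \<Rightarrow> bool" where
  "oriented_harsh_sum M1 M2 M \<longleftrightarrow>
     (\<exists>p1 q1 w1 p2 q2 w2. M1 = cyclic_word ((p1, q1) # w1) \<and> M2 = cyclic_word ((p2, q2) # w2) \<and>
        M = cyclic_word (w1 @ [(p1, q2)] @ w2 @ [(p2, q1)]))"

definition mild_sum :: "necklace \<Rightarrow> necklace \<Rightarrow> necklace \<Rightarrow> bool" where
  "mild_sum N1 N2 N \<longleftrightarrow>
     (\<exists>M1 M2 M. N1 = unoriented M1 \<and> N2 = unoriented M2 \<and> N = unoriented M \<and>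
        oriented_mild_sum M1 M2 M)"

definition harsh_sum :: "necklace \<Rightarrow> necklace \<Rightarrow> necklace \<Rightarrow> bool" where
  "harsh_sum N1 N2 N \<longleftrightarrow>
     (\<exists>M1 M2 M. N1 = unoriented M1 \<and> N2 = unoriented M2 \<and> N = unoriented M \<and>
        oriented_harsh_sum M1 M2 M)"

end

theory Submission
  imports Defs
begin

text \<open>
  The witness is the diagram \<open>(<<<\<circ>)\<^sup>3\<close>. The monodromy of \<open><<<\<circ>\<close> has trace \<open>\<plusminus>1\<close>, so it has order
  three and the monodromy of the whole diagram is the identity.

  Both kinds of necklace sum leave the same trace on the resulting cyclic word. If two diagrams
  with identity monodromy and \<open>n + 1\<close> stones each are summed, the result is a cyclic word
  \<open>a s b t\<close> with single stones \<open>s\<close>, \<open>t\<close> and chains \<open>a\<close>, \<open>b\<close> of length \<open>n\<close>, where each of \<open>a\<close> and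
  \<open>b\<close> can be closed up to a diagram with identity monodromy by one more stone. In a mild sum the
  closing stones are \<open>s\<close> and \<open>t\<close> themselves; in a harsh sum they are the two stones at which the
  diagrams were cut (\<open>oriented_sum_closable\<close>). Closability is invariant under reversing the
  orientation, so auxiliary orientations do not matter (\<open>sum_closable\<close>).

  For \<open>n = 5\<close> and the witness, the chains \<open>a\<close> and \<open>b\<close> start six places apart in a word of period
  four. Hence they are \<open><<<\<circ><\<close> and \<open><\<circ><<<\<close>, or \<open><<\<circ><<\<close> and \<open>\<circ><<<\<circ>\<close>, in some order. Neither
  \<open><<<\<circ><\<close> nor \<open>\<circ><<<\<circ>\<close> has a monodromy inverse to that of a stone, so one of the two chains is
  never closable.
\<close>

lemma chain_monodromy_eq_one_iff:
  "chain_monodromy w = \<one>\<^bsub>PSL2Z\<^esub> \<longleftrightarrow>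
    word_matrix (concat (map stone_word w)) \<in> {mat 1, - mat 1}"
  by (simp add: chain_monodromy_word psl_word_matrix PSL2Z_one psl_eq_iff)

lemma cyclic_word_eq_iff:
  assumes "v \<noteq> []" "w \<noteq> []"
  shows "cyclic_word v = cyclic_word w \<longleftrightarrow> same_cycle v w"
  using Quotient_rel[OF Quotient_oriented_necklace, of v w] assms by (simp add: same_cycle_refl)

lemma cyclic_word_rotate: "v @ w \<noteq> [] \<Longrightarrow> cyclic_word (v @ w) = cyclic_word (w @ v)"
  by (subst cyclic_word_eq_iff) (auto simp: same_cycle_iff)

lemma oriented_num_stones_cyclic_word:
  "w \<noteq> [] \<Longrightarrow> oriented_num_stones (cyclic_word w) = length w"
  by (simp add: oriented_num_stones.abs_eq same_cycle_refl)

lemma oriented_identity_monodromy_cyclic_word: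
  "w \<noteq> [] \<Longrightarrow> oriented_identity_monodromy (cyclic_word w) \<longleftrightarrow> chain_monodromy w = \<one>\<^bsub>PSL2Z\<^esub>"
  by (simp add: oriented_identity_monodromy.abs_eq same_cycle_refl)

lemma reverse_necklace_cyclic_word:
  "w \<noteq> [] \<Longrightarrow> reverse_necklace (cyclic_word w) = cyclic_word (map prod.swap (rev w))"
  by (simp add: reverse_necklace.abs_eq same_cycle_refl)


section \<open>Chains closed up by a single stone\<close>

definition closable :: "stone list \<Rightarrow> bool" where
  "closable w \<longleftrightarrow> (\<exists>s. chain_monodromy (s # w) = \<one>\<^bsub>PSL2Z\<^esub>)"

text \<open>Since \<open>gh = 1\<close> and \<open>hg = 1\<close> are equivalent, it does not matter at which end the closing stone
  is put; this is what makes the notion stable under reversal.\<close>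

lemma closable_snoc: "chain_monodromy (w @ [s]) = \<one>\<^bsub>PSL2Z\<^esub> \<Longrightarrow> closable w"
  using chain_monodromy_commute[of w "[s]"] unfolding closable_def append_Cons append_Nil by blast

lemma closable_reverse:
  assumes "closable w"
  shows "closable (map prod.swap (rev w))"
proof -
  obtain s where "chain_monodromy (s # w) = \<one>\<^bsub>PSL2Z\<^esub>" using assms unfolding closable_def by blast
  then have "chain_monodromy (map prod.swap (rev w) @ [prod.swap s]) = \<one>\<^bsub>PSL2Z\<^esub>"
    using chain_monodromy_reverse[of "s # w"] by simp
  then show ?thesis by (rule closable_snoc)
qed

definition closable_halves :: "nat \<Rightarrow> oriented_necklace \<Rightarrow> bool" where
  "closable_halves n M \<longleftrightarrow>
     (\<exists>a s b t. length a = n \<and> length b = n \<and> closable a \<and> closable b \<and>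
        M = cyclic_word (a @ [s] @ b @ [t]))"

lemma closable_halves_reverse:
  assumes "closable_halves n M"
  shows "closable_halves n (reverse_necklace M)"
proof -
  let ?r = "\<lambda>w. map prod.swap (rev w) :: stone list"
  obtain a s b t where *: "length a = n" "length b = n" "closable a" "closable b"
    "M = cyclic_word (a @ [s] @ b @ [t])"
    using assms unfolding closable_halves_def by blast
  have "reverse_necklace M = cyclic_word ([prod.swap t] @ ?r b @ [prod.swap s] @ ?r a)"
    by (simp add: *(5) reverse_necklace_cyclic_word)
  also have "\<dots> = cyclic_word (?r b @ [prod.swap s] @ ?r a @ [prod.swap t])"
    by (subst cyclic_word_rotate) simp_all
  finally show ?thesis
    unfolding closable_halves_def using *(1-4) closable_reverse
    by (intro exI[of _ "?r b"] exI[of _ "prod.swap s"] exI[of _ "?r a"] exI[of _ "prod.swap t"])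
       auto
qed


section \<open>Necklace sums have closable halves\<close>

text \<open>
  Cutting a cyclic word at a stone leaves a chain which that stone closes. A harsh sum keeps the
  two chains and only exchanges marks of the two cutting stones. A mild sum is the concatenation of
  two linear words, and the last letter of each of them plays the part of the cutting stone.
\<close>

lemma oriented_sum_closable:
  assumes "oriented_mild_sum M1 M2 M \<or> oriented_harsh_sum M1 M2 M"
    and n: "oriented_num_stones M1 = Suc n" "oriented_num_stones M2 = Suc n"
    and one: "oriented_identity_monodromy M1" "oriented_identity_monodromy M2"
  shows "closable_halves n M"
  using assms(1)
proof
  assume "oriented_mild_sum M1 M2 M"
  then obtain w1 w2 where w: "w1 \<noteq> []" "w2 \<noteq> []" "M1 = cyclic_word w1" "M2 = cyclic_word w2"
    "M = cyclic_word (w1 @ w2)"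
    unfolding oriented_mild_sum_def by blast
  obtain a s b t where "w1 = a @ [s]" "w2 = b @ [t]"
    using w(1,2) by (metis rev_exhaust)
  with w n one show ?thesis
    unfolding closable_halves_def
    by (intro exI[of _ a] exI[of _ s] exI[of _ b] exI[of _ t])
       (auto simp: oriented_num_stones_cyclic_word oriented_identity_monodromy_cyclic_word
         intro: closable_snoc)
next
  assume "oriented_harsh_sum M1 M2 M"
  then obtain p1 q1 w1 p2 q2 w2 where w: "M1 = cyclic_word ((p1, q1) # w1)"
    "M2 = cyclic_word ((p2, q2) # w2)" "M = cyclic_word (w1 @ [(p1, q2)] @ w2 @ [(p2, q1)])"
    unfolding oriented_harsh_sum_def by blast
  with n one have "length w1 = n" "length w2 = n" "closable w1" "closable w2"
    by (auto simp: closable_def oriented_num_stones_cyclic_word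
        oriented_identity_monodromy_cyclic_word)
  with w(3) show ?thesis unfolding closable_halves_def by blast
qed

lemma sum_closable:
  assumes "mild_sum N1 N2 (unoriented M) \<or> harsh_sum N1 N2 (unoriented M)"
    and "num_stones N1 = Suc n" "num_stones N2 = Suc n"
    and "identity_monodromy N1" "identity_monodromy N2"
  shows "closable_halves n M"
proof -
  obtain M1 M2 M' where *: "N1 = unoriented M1" "N2 = unoriented M2"
    "unoriented M = unoriented M'" "oriented_mild_sum M1 M2 M' \<or> oriented_harsh_sum M1 M2 M'"
    using assms(1) unfolding mild_sum_def harsh_sum_def by blast
  have M': "closable_halves n M'"
    using oriented_sum_closable[OF *(4)] assms(2-5)
    by (simp add: *(1,2) num_stones.abs_eq identity_monodromy.abs_eq)
  have "same_unoriented M' M" using *(3) by (metis necklace.abs_eq_iff)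
  then show ?thesis
    using M' closable_halves_reverse by (auto simp: same_unoriented_def)
qed


section \<open>The diagram without closable halves\<close>

definition witness :: "stone list" where
  "witness = concat (replicate 3 [lt_stone, lt_stone, lt_stone, circle_stone])"

lemma witness_expand:
  "witness = [lt_stone, lt_stone, lt_stone, circle_stone, lt_stone, lt_stone, lt_stone, circle_stone,
     lt_stone, lt_stone, lt_stone, circle_stone]"
  by (simp add: witness_def numeral_3_eq_3)

lemma witness_monodromy: "chain_monodromy witness = \<one>\<^bsub>PSL2Z\<^esub>"
  by (simp add: chain_monodromy_eq_one_iff witness_expand mat2_one)

text \<open>Up to sign the matrix of this chain is \<open>(1, -1; 4, -3)\<close>. It is parabolic, as the stones are,
  but its fixed point \<open>1/2\<close> on the projective line is not the fixed point \<open>0\<close>, \<open>\<infinity>\<close>, \<open>1\<close> or \<open>-1\<close> of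
  any of them.\<close>

lemma not_closable_lt_lt_lt_circle_lt:
  "\<not> closable [lt_stone, lt_stone, lt_stone, circle_stone, lt_stone]"
proof
  assume "closable [lt_stone, lt_stone, lt_stone, circle_stone, lt_stone]"
  then obtain s where
    "chain_monodromy [s, lt_stone, lt_stone, lt_stone, circle_stone, lt_stone] = \<one>\<^bsub>PSL2Z\<^esub>"
    unfolding closable_def by blast
  then show False
    by (cases s rule: stone_word.cases) (simp_all add: chain_monodromy_eq_one_iff mat2_one)
qed

text \<open>The matrix of this chain has trace \<open>\<plusminus>4\<close>, so it is hyperbolic, while every stone is parabolic.\<close>

lemma not_closable_circle_lt_lt_lt_circle:
  "\<not> closable [circle_stone, lt_stone, lt_stone, lt_stone, circle_stone]"
proof
  assume "closable [circle_stone, lt_stone, lt_stone, lt_stone, circle_stone]"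
  then obtain s where
    "chain_monodromy [s, circle_stone, lt_stone, lt_stone, lt_stone, circle_stone] = \<one>\<^bsub>PSL2Z\<^esub>"
    unfolding closable_def by blast
  then show False
    by (cases s rule: stone_word.cases) (simp_all add: chain_monodromy_eq_one_iff mat2_one)
qed

lemma rotate_witness_cases:
  obtains k where "k \<in> {0, 1, 2, 3}" "rotate n witness = rotate k witness"
proof
  have period: "rotate 4 witness = witness"
    by (simp add: witness_expand numeral_eq_Suc)
  have "rotate (4 * m) witness = witness" for m
  proof (induction m)
    case (Suc m)
    then show ?case using period rotate_rotate[of 4 "4 * m" witness] by simp
  qed simp
  then show "rotate n witness = rotate (n mod 4) witness"
    using rotate_rotate[of "n mod 4" "4 * (n div 4)" witness] by simp
  show "n mod 4 \<in> {0, 1, 2, 3}" by auto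
qed

lemma witness_not_closable_halves: "\<not> closable_halves 5 (cyclic_word witness)"
proof
  assume "closable_halves 5 (cyclic_word witness)"
  then obtain a s b t where *: "length a = 5" "length b = 5" "closable a" "closable b"
    "cyclic_word witness = cyclic_word (a @ [s] @ b @ [t])"
    unfolding closable_halves_def by blast
  then have "same_cycle witness (a @ [s] @ b @ [t])"
    by (subst (asm) cyclic_word_eq_iff) (auto simp: witness_expand)
  then obtain n where "rotate n witness = a @ [s] @ b @ [t]" by (auto simp: same_cycle_def)
  then obtain k where k: "k \<in> {0, 1, 2, 3}" and eq: "rotate k witness = a @ [s] @ b @ [t]"
    by (metis rotate_witness_cases)
  have a: "a = take 5 (rotate k witness)" and b: "b = take 5 (drop 6 (rotate k witness))"
    using *(1,2) by (simp_all add: eq)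
  consider "k = 0" | "k = 1" | "k = 2" | "k = 3" using k by blast
  then show False
  proof cases
    case 1
    then have "a = [lt_stone, lt_stone, lt_stone, circle_stone, lt_stone]"
      by (simp add: a witness_expand)
    with *(3) not_closable_lt_lt_lt_circle_lt show False by simp
  next
    case 2
    then have "b = [circle_stone, lt_stone, lt_stone, lt_stone, circle_stone]"
      by (simp add: b witness_expand numeral_eq_Suc)
    with *(4) not_closable_circle_lt_lt_lt_circle show False by simp
  next
    case 3
    then have "b = [lt_stone, lt_stone, lt_stone, circle_stone, lt_stone]"
      by (simp add: b witness_expand numeral_eq_Suc)
    with *(4) not_closable_lt_lt_lt_circle_lt show False by simp
  next
    case 4
    then have "a = [circle_stone, lt_stone, lt_stone, lt_stone, circle_stone]"
      by (simp add: a witness_expand numeral_eq_Suc)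
    with *(3) not_closable_circle_lt_lt_lt_circle show False by simp
  qed
qed

theorem proposition6p5:
  shows "\<exists>N :: necklace. num_stones N = 12 \<and> identity_monodromy N \<and>
    \<not> (\<exists>N1 N2 :: necklace.
          num_stones N1 = 6 \<and> identity_monodromy N1 \<and>
          num_stones N2 = 6 \<and> identity_monodromy N2 \<and>
          (mild_sum N1 N2 N \<or> harsh_sum N1 N2 N))"
proof (intro exI[of _ "unoriented (cyclic_word witness)"] conjI notI)
  have w: "witness \<noteq> []" "length witness = 12" by (simp_all add: witness_expand)
  show "num_stones (unoriented (cyclic_word witness)) = 12"
    using w by (simp add: num_stones.abs_eq oriented_num_stones_cyclic_word)
  show "identity_monodromy (unoriented (cyclic_word witness))"
    using w witness_monodromy
    by (simp add: identity_monodromy.abs_eq oriented_identity_monodromy_cyclic_word)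
  assume "\<exists>N1 N2. num_stones N1 = 6 \<and> identity_monodromy N1 \<and>
    num_stones N2 = 6 \<and> identity_monodromy N2 \<and>
    (mild_sum N1 N2 (unoriented (cyclic_word witness)) \<or>
     harsh_sum N1 N2 (unoriented (cyclic_word witness)))"
  then have "closable_halves 5 (cyclic_word witness)"
    using sum_closable[where n = 5] by auto
  then show False using witness_not_closable_halves by contradiction
qed

end
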